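(* Let $P_{(1,1)}$ be the set of all cylindric partitions with profile $c=(1,1)$. Then, as formal power series in $q$ (equivalently, for $|q|<1$), $$\sum_{\Lambda\in P_{(1,1)}} q^{|\Lambda|}=\frac{(-q;q^2)_\infty}{(q;q)_\infty}.$$
   Context: Let $r,\ell$ be positive integers and $c=(c_1,\dots,c_r)$ a composition of $\ell$ into $r$ nonnegative integer parts (zero entries allowed). A cylindric partition with profile $c$ is a tuple $\Lambda=(\lambda^{(1)},\dots,\lambda^{(r)})$ of ordinary partitions $\lambda^{(i)}=(\lambda^{(i)}_1\ge\lambda^{(i)}_2\ge\cdots)$ (parts beyond the length are taken to be $0$) such that for all $i,j$: $\lambda^{(i)}_j\ge\lambda^{(i+1)}_{j+c_{i+1}}$ for $1\le i\le r-1$, and $\lambda^{(r)}_j\ge\lambda^{(1)}_{j+c_1}$. Here $r$ is the rank and $\ell$ the level. The size $|\Lambda|$ is the sum of all parts of all $\lambda^{(i)}$; the empty cylindric partition (all $\lambda^{(i)}$ empty) is included and has size $0$. Notation: $(a;q)_n=\prod_{k=1}^n(1-aq^{k-1})$, $(a;q)_\infty=\lim_{n\to\infty}(a;q)_n$. *)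

theory Defs
  imports
    "HOL-Analysis.Infinite_Sum"
    "HOL-Computational_Algebra.Formal_Power_Series"
begin

(* A partition is its sequence of parts padded with zeros: lam j is the (j+1)-st part. *)
definition is_partition :: "(nat \<Rightarrow> nat) \<Rightarrow> bool" where
  "is_partition lam \<longleftrightarrow> antimono lam \<and> finite {j. lam j \<noteq> 0}"

definition partition_size :: "(nat \<Rightarrow> nat) \<Rightarrow> nat" where
  "partition_size lam = (\<Sum>j\<in>{j. lam j \<noteq> 0}. lam j)"

(* The profile c (a nonempty list) determines the rank r = length c and the level sum_list c.
   Components are counted from 0: L ! i is the (i+1)-st partition and c ! i the (i+1)-st
   entry of the profile. *)
definition cylindric_partitions :: "nat list \<Rightarrow> (nat \<Rightarrow> nat) list set" where
  "cylindric_partitions c =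
    {L. length L = length c \<and> (\<forall>lam\<in>set L. is_partition lam) \<and>
        (\<forall>i j. Suc i < length c \<longrightarrow> (L ! i) j \<ge> (L ! Suc i) (j + c ! Suc i)) \<and>
        (\<forall>j. (L ! (length c - 1)) j \<ge> (L ! 0) (j + c ! 0))}"

definition cylindric_size :: "(nat \<Rightarrow> nat) list \<Rightarrow> nat" where
  "cylindric_size L = (\<Sum>lam\<leftarrow>L. partition_size lam)"

definition qpoch :: "'a::comm_ring_1 \<Rightarrow> 'a \<Rightarrow> nat \<Rightarrow> 'a" where
  "qpoch a q n = (\<Prod>k=1..n. 1 - a * q ^ (k - 1))"

(* For formal power series the limit is taken in the topology of coefficientwise stabilisation. *)
definition qpoch_inf :: "'a::{comm_ring_1,t2_space} \<Rightarrow> 'a \<Rightarrow> 'a" where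
  "qpoch_inf a q = lim (\<lambda>n. qpoch a q n)"

end

(* For profile (1,1) the defining conditions on a pair (lam, mu) say exactly that
   max (lam (j+1)) (mu (j+1)) <= min (lam j) (mu j) for all j. So a pair is encoded by the
   integers lam j - mu j together with the natural numbers
   min (lam j) (mu j) - max (lam (j+1)) (mu (j+1)); in the size these enter with weights 2j+1
   (in absolute value) and 2j+2. An integer of weight w contributes the factor
   (1 + q^w) / (1 - q^w), a natural number the factor 1 / (1 - q^w). *)
theory Submission imports Defs begin

section \<open>Sums of powers of X as counts of fibres\<close>

text \<open>In the topology of coefficientwise stabilisation a sum converges exactly when each
  coefficient receives finitely many nonzero contributions, and \<open>fps_X ^ s x\<close>
  contributes 1 to coefficient \<open>s x\<close> only. Later sums thereby become counting
  problems.\<close>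

lemma has_sum_fps_X_power_iff:
  fixes s :: "'b \<Rightarrow> nat" and F :: "'a :: comm_ring_1 fps"
  shows "((\<lambda>x. fps_X ^ s x) has_sum F) A \<longleftrightarrow>
         (\<forall>n. finite {x\<in>A. s x = n} \<and> fps_nth F n = of_nat (card {x\<in>A. s x = n}))"
proof -
  have eq: "{x \<in> A. fps_nth (fps_X ^ s x :: 'a fps) n \<noteq> 0} = {x\<in>A. s x = n}" for n
    by auto
  have sum: "(\<Sum>x\<in>{x\<in>A. s x = n}. fps_nth (fps_X ^ s x :: 'a fps) n) =
             of_nat (card {x\<in>A. s x = n})" for n
    by simp
  show ?thesis
    using has_sum_fpsI[of A "\<lambda>x. fps_X ^ s x :: 'a fps" F]
          has_sum_fpsD[of "\<lambda>x. fps_X ^ s x :: 'a fps" A F]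
    unfolding eq sum by blast
qed

text \<open>The fibre over \<open>n\<close> is the disjoint union, over \<open>i\<close>, of
  products of the fibres over \<open>i\<close> and \<open>n - i\<close>; counting it gives the
  Cauchy product.\<close>

lemma has_sum_fps_X_power_Times:
  fixes F G :: "'a :: comm_ring_1 fps"
  assumes "((\<lambda>x. fps_X ^ s x) has_sum F) A" "((\<lambda>y. fps_X ^ t y) has_sum G) B"
  shows   "((\<lambda>z. fps_X ^ (s (fst z) + t (snd z))) has_sum F * G) (A \<times> B)"
  unfolding has_sum_fps_X_power_iff
proof (intro allI conjI)
  fix n
  define P where "P i = {x\<in>A. s x = i} \<times> {y\<in>B. t y = n - i}" for i
  have fin: "finite {x\<in>A. s x = i}" "finite {y\<in>B. t y = i}" for i
    using assms unfolding has_sum_fps_X_power_iff by auto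
  have eq: "{z \<in> A \<times> B. s (fst z) + t (snd z) = n} = (\<Union>i\<in>{0..n}. P i)"
    by (auto simp: P_def)
  show "finite {z \<in> A \<times> B. s (fst z) + t (snd z) = n}"
    unfolding eq by (auto simp: P_def fin)
  have "card (\<Union>i\<in>{0..n}. P i) = (\<Sum>i=0..n. card (P i))"
    by (rule card_UN_disjoint) (auto simp: P_def fin)
  then show "fps_nth (F * G) n = of_nat (card {z \<in> A \<times> B. s (fst z) + t (snd z) = n})"
    using assms unfolding has_sum_fps_X_power_iff
    by (simp add: eq fps_mult_nth P_def card_cartesian_product)
qed

text \<open>For each \<open>n\<close> a single index \<open>N\<close>, at which both the fibre over
  \<open>n\<close> and the \<open>n\<close>-th coefficient have stabilised, settles the
  claim.\<close>

lemma has_sum_fps_X_power_limit: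
  fixes F :: "nat \<Rightarrow> 'a :: comm_ring_1 fps"
  assumes sums: "\<And>N. ((\<lambda>x. fps_X ^ s x) has_sum F N) (A N)"
    and lim: "F \<longlonglongrightarrow> G"
    and fibre: "\<And>n. eventually (\<lambda>N. {x\<in>A N. s x = n} = {x\<in>B. s x = n}) sequentially"
  shows "((\<lambda>x. fps_X ^ s x) has_sum G) B"
  unfolding has_sum_fps_X_power_iff
proof
  fix n
  have "eventually (\<lambda>N. fps_nth (F N) n = fps_nth G n) sequentially"
    using lim unfolding tendsto_fps_iff by blast
  with fibre[of n] have "eventually (\<lambda>N. {x\<in>A N. s x = n} = {x\<in>B. s x = n} \<and>
      fps_nth (F N) n = fps_nth G n) sequentially"
    by (rule eventually_conj)
  then obtain N where "{x\<in>A N. s x = n} = {x\<in>B. s x = n}" "fps_nth (F N) n = fps_nth G n"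
    by (auto dest!: eventually_happens)
  with sums[of N] show "finite {x\<in>B. s x = n} \<and> fps_nth G n = of_nat (card {x\<in>B. s x = n})"
    unfolding has_sum_fps_X_power_iff by metis
qed

lemma inverse_one_minus_fps_X_power:
  fixes w :: nat
  assumes "w > 0"
  shows "inverse (1 - fps_X ^ w :: 'a :: field fps) = Abs_fps (\<lambda>n. if w dvd n then 1 else 0)"
proof (rule fps_inverse_unique)
  show "(1 - fps_X ^ w :: 'a fps) * Abs_fps (\<lambda>n. if w dvd n then 1 else 0) = 1"
  proof (rule fps_ext)
    fix n
    show "fps_nth ((1 - fps_X ^ w :: 'a fps) * Abs_fps (\<lambda>n. if w dvd n then 1 else 0)) n =
          fps_nth 1 n"
      \<comment> \<open>The two contributions cancel for \<open>n >= w\<close>; below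
        \<open>w\<close> only \<open>n = 0\<close> is divisible by \<open>w\<close>.\<close>
      using assms
      by (auto simp: algebra_simps fps_X_power_mult_nth dvd_minus_self dest: dvd_imp_le)
  qed
qed

lemma has_sum_fps_X_power_nat:
  assumes "w > 0"
  shows "((\<lambda>m. fps_X ^ (w * m)) has_sum inverse (1 - fps_X ^ w :: 'a :: field fps)) UNIV"
  unfolding has_sum_fps_X_power_iff
proof
  fix n
  have "{m \<in> UNIV. w * m = n} = (if w dvd n then {n div w} else {})"
    using assms by auto
  then show "finite {m \<in> UNIV. w * m = n} \<and>
      fps_nth (inverse (1 - fps_X ^ w :: 'a fps)) n = of_nat (card {m \<in> UNIV. w * m = n})"
    using assms by (simp add: inverse_one_minus_fps_X_power)
qed

text \<open>A positive multiple of \<open>w\<close> comes from both \<open>d\<close> and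
  \<open>-d\<close>, but 0 only from \<open>d = 0\<close>.\<close>

lemma has_sum_fps_X_power_int:
  assumes "w > 0"
  shows "((\<lambda>d :: int. fps_X ^ (w * nat \<bar>d\<bar>)) has_sum
          (1 + fps_X ^ w) * inverse (1 - fps_X ^ w :: 'a :: field fps)) UNIV"
  unfolding has_sum_fps_X_power_iff
proof
  fix n
  have "(1 - fps_X ^ w :: 'a fps) * inverse (1 - fps_X ^ w) = 1"
    using assms by (intro inverse_mult_eq_1') simp
  \<comment> \<open>Writing \<open>1 + fps_X ^ w\<close> as \<open>2 - (1 - fps_X ^ w)\<close> lets
    the coefficients be read off the geometric series.\<close>
  then have "(1 + fps_X ^ w) * inverse (1 - fps_X ^ w :: 'a fps) =
             2 * inverse (1 - fps_X ^ w) - 1"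
    by (simp add: algebra_simps)
  then have nth: "fps_nth ((1 + fps_X ^ w) * inverse (1 - fps_X ^ w :: 'a fps)) n =
      (if n = 0 then 1 else if w dvd n then 2 else 0)"
    using assms by (simp add: inverse_one_minus_fps_X_power fps_numeral_fps_const)
  have set: "{d :: int. w * nat \<bar>d\<bar> = n} =
      (if w dvd n then {int (n div w), - int (n div w)} else {})"
    using assms by (auto simp: abs_if split: if_splits)
  have "int (n div w) = - int (n div w) \<longleftrightarrow> n = 0" if "w dvd n"
    using that assms by auto
  then show "finite {d :: int \<in> UNIV. w * nat \<bar>d\<bar> = n} \<and>
      fps_nth ((1 + fps_X ^ w) * inverse (1 - fps_X ^ w :: 'a fps)) n =
      of_nat (card {d :: int \<in> UNIV. w * nat \<bar>d\<bar> = n})"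
    by (auto simp: nth set card_insert_if)
qed

section \<open>Convergence of the q-products\<close>

lemma tendsto_mult_fps:
  fixes f g :: "'b \<Rightarrow> 'a :: comm_ring_1 fps"
  assumes "(f \<longlongrightarrow> F) net" "(g \<longlongrightarrow> G) net"
  shows   "((\<lambda>x. f x * g x) \<longlongrightarrow> F * G) net"
proof (rule tendsto_fpsI)
  fix n
  \<comment> \<open>Coefficient \<open>n\<close> of a product involves only the finitely many
    coefficients up to \<open>n\<close> of the factors.\<close>
  have "eventually (\<lambda>x. \<forall>i\<in>{..n}. fps_nth (f x) i = fps_nth F i) net"
       "eventually (\<lambda>x. \<forall>i\<in>{..n}. fps_nth (g x) i = fps_nth G i) net"
    using assms unfolding tendsto_fps_iff by (auto intro!: eventually_ball_finite)
  then show "eventually (\<lambda>x. fps_nth (f x * g x) n = fps_nth (F * G) n) net"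
    by eventually_elim (simp add: fps_mult_nth)
qed

lemma qpoch_Suc: "qpoch a q (Suc n) = qpoch a q n * (1 - a * q ^ n)"
  by (simp add: qpoch_def)

lemma qpoch_eq_prod: "qpoch a q (Suc n) = (\<Prod>k\<le>n. 1 - a * q ^ k)"
  by (induction n) (simp_all add: qpoch_Suc, simp add: qpoch_def)

lemma qpoch_fps_nth_0:
  fixes a q :: "'a :: comm_ring_1 fps"
  assumes "fps_nth a 0 = 0"
  shows "fps_nth (qpoch a q n) 0 = 1"
  using assms by (induction n) (simp_all add: qpoch_Suc, simp add: qpoch_def)

text \<open>The factor with index \<open>k\<close> differs from 1 only in degrees above
  \<open>k\<close>, so the product converges; this is what gives the \<open>lim\<close> in
  \<open>qpoch_inf\<close> its meaning.\<close>

lemma tendsto_qpoch_fps: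
  fixes a q :: "'a :: {idom, t2_space} fps"
  assumes a: "subdegree a > 0" and q: "subdegree q > 0"
  shows "qpoch a q \<longlonglongrightarrow> qpoch_inf a q"
proof -
  from a q have nz: "a \<noteq> 0" "q \<noteq> 0" by auto
  have "fps_nth (1 - a * q ^ k) 0 = 1" for k
    using nth_less_subdegree_zero[OF a] by simp
  then have "1 - a * q ^ k \<noteq> 0" for k
    by (metis fps_zero_nth zero_neq_one)
  moreover have "subdegree (1 - a * q ^ k - 1) > n" if "k > n" for n k
  proof -
    have "subdegree (1 - a * q ^ k - 1) = subdegree a + k * subdegree q"
      using nz by simp
    moreover have "k * subdegree q \<ge> k * 1"
      using q by (intro mult_le_mono2) simp
    ultimately show ?thesis
      using that by linarith
  qed
  ultimately have "convergent (\<lambda>n. \<Prod>k\<le>n. 1 - a * q ^ k)"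
    unfolding convergent_def
    using tendsto_prod_fps[of "\<lambda>k. 1 - a * q ^ k" "\<lambda>n. n"] by blast
  then have "convergent (\<lambda>n. qpoch a q (Suc n))"
    by (simp add: qpoch_eq_prod)
  then have "convergent (qpoch a q)"
    by (simp add: convergent_Suc_iff)
  then show ?thesis
    by (simp add: convergent_LIMSEQ_iff qpoch_inf_def)
qed

text \<open>Makes the infinite product in the denominator a unit.\<close>

lemma qpoch_inf_fps_nth_0:
  fixes a q :: "'a :: {idom, t2_space} fps"
  assumes "subdegree a > 0" "subdegree q > 0"
  shows "fps_nth (qpoch_inf a q) 0 = 1"
proof -
  have "eventually (\<lambda>n. fps_nth (qpoch a q n) 0 = fps_nth (qpoch_inf a q) 0) sequentially"
    using tendsto_qpoch_fps[OF assms] unfolding tendsto_fps_iff by blast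
  then show ?thesis
    using assms(1) by (auto simp: qpoch_fps_nth_0 dest: eventually_happens)
qed

section \<open>Interlaced pairs and the removal of their last row\<close>

definition interlaced :: "nat \<Rightarrow> ((nat \<Rightarrow> nat) \<times> (nat \<Rightarrow> nat)) set" where
  "interlaced N = {(lam, mu). (\<forall>j. max (lam (Suc j)) (mu (Suc j)) \<le> min (lam j) (mu j)) \<and>
                              (\<forall>j\<ge>N. lam j = 0 \<and> mu j = 0)}"

definition pair_size :: "(nat \<Rightarrow> nat) \<times> (nat \<Rightarrow> nat) \<Rightarrow> nat" where
  "pair_size p = partition_size (fst p) + partition_size (snd p)"

lemma support_subset_lessThan:
  fixes lam :: "nat \<Rightarrow> nat"
  assumes "\<And>j. j \<ge> N \<Longrightarrow> lam j = 0"
  shows "{j. lam j \<noteq> 0} \<subseteq> {..<N}"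
proof
  fix j assume "j \<in> {j. lam j \<noteq> 0}"
  then show "j \<in> {..<N}"
    using assms[of j] by (cases "j < N") auto
qed

lemma partition_size_eq_sum:
  assumes "\<And>j. j \<ge> N \<Longrightarrow> lam j = 0"
  shows "partition_size lam = sum lam {..<N}"
  unfolding partition_size_def
  by (intro sum.mono_neutral_left support_subset_lessThan assms) auto

lemma pair_size_eq_sum:
  assumes "(lam, mu) \<in> interlaced N"
  shows "pair_size (lam, mu) = (\<Sum>j<N. lam j + mu j)"
  using assms
  by (simp add: pair_size_def interlaced_def partition_size_eq_sum[of N] sum.distrib)

text \<open>In the conjugate of the partition formed by all parts of \<open>lam\<close> and \<open>mu\<close>, this removes the parts
  of size \<open>2 * N + 1\<close> (recorded with a sign in the integer) and \<open>2 * N + 2\<close>.\<close>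

definition strip :: "nat \<Rightarrow> (nat \<Rightarrow> nat) \<times> (nat \<Rightarrow> nat) \<Rightarrow>
    ((nat \<Rightarrow> nat) \<times> (nat \<Rightarrow> nat)) \<times> int \<times> nat" where
  "strip N = (\<lambda>(lam, mu). ((\<lambda>j. lam j - max (lam N) (mu N), \<lambda>j. mu j - max (lam N) (mu N)),
                           int (lam N) - int (mu N), min (lam N) (mu N)))"

text \<open>Since \<open>nat\<close> sends negative integers to 0, row \<open>N\<close> becomes a
  pair with minimum \<open>m\<close> and signed difference \<open>d\<close>, hence with maximum
  \<open>m + nat |d|\<close>, the amount by which earlier rows are raised.\<close>

definition unstrip :: "nat \<Rightarrow> ((nat \<Rightarrow> nat) \<times> (nat \<Rightarrow> nat)) \<times> int \<times> nat \<Rightarrow>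
    (nat \<Rightarrow> nat) \<times> (nat \<Rightarrow> nat)" where
  "unstrip N = (\<lambda>((lam, mu), d, m).
     (\<lambda>j. if j < N then lam j + m + nat \<bar>d\<bar> else if j = N then m + nat d else 0,
      \<lambda>j. if j < N then mu j + m + nat \<bar>d\<bar> else if j = N then m + nat (- d) else 0))"

lemma interlaced_antimono:
  assumes "(lam, mu) \<in> interlaced N" "i < j"
  shows "max (lam j) (mu j) \<le> min (lam i) (mu i)"
  using assms(2)
proof (induction j)
  case (Suc j)
  have "max (lam (Suc j)) (mu (Suc j)) \<le> min (lam j) (mu j)"
    using assms(1) by (auto simp: interlaced_def)
  moreover have "i = j \<or> max (lam j) (mu j) \<le> min (lam i) (mu i)"
    using Suc by (auto simp: less_Suc_eq)
  ultimately show ?case by auto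
qed simp

lemma strip_in:
  assumes "p \<in> interlaced (Suc N)"
  shows "strip N p \<in> interlaced N \<times> UNIV \<times> UNIV"
proof -
  obtain lam mu where p: "p = (lam, mu)" by fastforce
  have "max (lam (Suc j)) (mu (Suc j)) \<le> min (lam j) (mu j)" for j
    using assms by (auto simp: p interlaced_def)
  \<comment> \<open>Truncated subtraction therefore turns all rows from \<open>N\<close> on into
    0.\<close>
  moreover have "lam j \<le> max (lam N) (mu N)" "mu j \<le> max (lam N) (mu N)" if "j \<ge> N" for j
    using interlaced_antimono[of lam mu "Suc N" N j] assms that by (cases "j = N"; force simp: p)+
  ultimately show ?thesis
    by (auto simp: p strip_def interlaced_def intro: diff_le_mono)
qed

lemma unstrip_in:
  assumes "z \<in> interlaced N \<times> UNIV \<times> UNIV"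
  shows "unstrip N z \<in> interlaced (Suc N)"
proof -
  obtain lam mu d m where z: "z = ((lam, mu), d, m)" by (cases z) auto
  have "lam (Suc j) \<le> lam j" "lam (Suc j) \<le> mu j" "mu (Suc j) \<le> lam j" "mu (Suc j) \<le> mu j" for j
    using assms by (auto simp: z interlaced_def)
  then show ?thesis
    by (auto simp: z unstrip_def interlaced_def)
qed

lemma unstrip_strip:
  assumes "p \<in> interlaced (Suc N)"
  shows "unstrip N (strip N p) = p"
proof -
  obtain lam mu where p: "p = (lam, mu)" by fastforce
  \<comment> \<open>In the rows before \<open>N\<close> the subtraction is thus never truncated and
    can be undone.\<close>
  have 1: "lam j \<ge> max (lam N) (mu N)" "mu j \<ge> max (lam N) (mu N)" if "j < N" for j
    using interlaced_antimono[of lam mu "Suc N" j N] assms that by (auto simp: p)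
  have 2: "lam j = 0" "mu j = 0" if "j > N" for j
    using assms that by (auto simp: p interlaced_def)
  have 3: "min (lam N) (mu N) + nat \<bar>int (lam N) - int (mu N)\<bar> = max (lam N) (mu N)"
    by (auto simp: min_def max_def)
  have 4: "lam j - max (lam N) (mu N) + min (lam N) (mu N) + nat \<bar>int (lam N) - int (mu N)\<bar> = lam j"
       "mu j - max (lam N) (mu N) + min (lam N) (mu N) + nat \<bar>int (lam N) - int (mu N)\<bar> = mu j"
    if "j < N" for j
    using 1[OF that] 3 by linarith+
  show ?thesis
    using 2 by (auto simp: p strip_def unstrip_def fun_eq_iff 4)
qed

lemma strip_unstrip:
  assumes "z \<in> interlaced N \<times> UNIV \<times> UNIV"
  shows "strip N (unstrip N z) = z"
proof -
  obtain lam mu d m where z: "z = ((lam, mu), d, m)" by (cases z) auto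
  have "lam j = 0" "mu j = 0" if "j \<ge> N" for j
    using assms that by (auto simp: z interlaced_def)
  \<comment> \<open>So \<open>strip\<close> subtracts exactly what \<open>unstrip\<close>
    added.\<close>
  moreover have "max (m + nat d) (m + nat (- d)) = m + nat \<bar>d\<bar>"
    by auto
  ultimately show ?thesis
    by (auto simp: z strip_def unstrip_def fun_eq_iff)
qed

text \<open>Each of the \<open>N\<close> earlier rows gains \<open>2 * (m + nat |d|)\<close> and row
  \<open>N\<close> holds \<open>2 * m + nat |d|\<close>; collecting terms yields the two
  weights.\<close>

lemma pair_size_unstrip:
  assumes "(p, d, m) \<in> interlaced N \<times> UNIV \<times> UNIV"
  shows "pair_size (unstrip N (p, d, m)) =
         pair_size p + ((2 * N + 1) * nat \<bar>d\<bar> + (2 * N + 2) * m)"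
proof -
  obtain lam mu where p: "p = (lam, mu)" by fastforce
  obtain lam' mu' where u: "unstrip N (p, d, m) = (lam', mu')" by fastforce
  have "(\<Sum>j<N. lam' j + mu' j) = (\<Sum>j<N. lam j + mu j + 2 * (m + nat \<bar>d\<bar>))"
    by (rule sum.cong) (use u in \<open>auto simp: p unstrip_def\<close>)
  moreover have "lam' N + mu' N = 2 * m + nat \<bar>d\<bar>"
    using u by (auto simp: p unstrip_def)
  ultimately have "(\<Sum>j<Suc N. lam' j + mu' j) =
      (\<Sum>j<N. lam j + mu j) + ((2 * N + 1) * nat \<bar>d\<bar> + (2 * N + 2) * m)"
    by (simp add: sum.distrib algebra_simps)
  moreover have "(lam', mu') \<in> interlaced (Suc N)"
    using unstrip_in[OF assms] u by simp
  moreover have "(lam, mu) \<in> interlaced N"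
    using assms p by simp
  ultimately show ?thesis
    unfolding u unfolding p by (simp only: pair_size_eq_sum)
qed

section \<open>Generating function for a bounded number of rows\<close>

text \<open>Each new row brings one factor into the numerator but two, of weights
  \<open>2 * N + 1\<close> and \<open>2 * N + 2\<close>, into the denominator, whence the index
  \<open>2 * N\<close> there.\<close>

lemma has_sum_interlaced:
  "((\<lambda>p. fps_X ^ pair_size p) has_sum
    qpoch (- fps_X) (fps_X ^ 2) N * inverse (qpoch fps_X fps_X (2 * N) :: 'a :: field fps))
   (interlaced N)"
proof (induction N)
  case 0
  have "interlaced 0 = {(\<lambda>_. 0, \<lambda>_. 0)}"
    by (auto simp: interlaced_def fun_eq_iff)
  moreover have "pair_size (\<lambda>_. 0, \<lambda>_. 0) = 0"
    by (simp add: pair_size_def partition_size_def)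
  ultimately show ?case
    using has_sum_finite[of "{(\<lambda>_. 0, \<lambda>_. 0)}" "\<lambda>p. fps_X ^ pair_size p :: 'a fps"]
    by (simp add: qpoch_def)
next
  case (Suc N)
  let ?w = "2 * N + 1"
  let ?G = "(1 + fps_X ^ ?w) * inverse (1 - fps_X ^ ?w) * inverse (1 - fps_X ^ (?w + 1)) :: 'a fps"
  let ?F = "\<lambda>N. qpoch (- fps_X) (fps_X ^ 2) N * inverse (qpoch fps_X fps_X (2 * N) :: 'a fps)"
  have "((\<lambda>z. fps_X ^ (?w * nat \<bar>fst z\<bar> + (?w + 1) * snd z)) has_sum ?G) (UNIV \<times> UNIV)"
    by (intro has_sum_fps_X_power_Times has_sum_fps_X_power_int has_sum_fps_X_power_nat) auto
  then have "((\<lambda>z. fps_X ^ (pair_size (fst z) + (?w * nat \<bar>fst (snd z)\<bar> + (?w + 1) * snd (snd z))))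
      has_sum ?F N * ?G) (interlaced N \<times> UNIV \<times> UNIV)"
    by (rule has_sum_fps_X_power_Times[OF Suc.IH])
  moreover have "?F N * ?G = ?F (Suc N)"
  proof -
    have "qpoch fps_X fps_X (2 * Suc N) =
        qpoch fps_X fps_X (2 * N) * (1 - fps_X ^ ?w) * (1 - fps_X ^ (?w + 1) :: 'a fps)"
      by (simp add: qpoch_Suc)
    moreover have "qpoch (- fps_X) (fps_X ^ 2) (Suc N) =
        qpoch (- fps_X) (fps_X ^ 2) N * (1 + fps_X ^ ?w :: 'a fps)"
      by (simp add: qpoch_Suc power_mult)
    ultimately show ?thesis
      by (simp only: fps_inverse_mult mult_ac)
  qed
  ultimately have "((\<lambda>z. fps_X ^ (pair_size (fst z) + (?w * nat \<bar>fst (snd z)\<bar> + (?w + 1) * snd (snd z))))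
      has_sum ?F (Suc N)) (interlaced N \<times> UNIV \<times> UNIV)"
    by simp
  \<comment> \<open>The sum over triples is carried along the bijection \<open>unstrip N\<close>;
    \<open>pair_size_unstrip\<close> matches the exponents.\<close>
  then show ?case
    by (subst (asm) has_sum_reindex_bij_witness[where i = "strip N" and j = "unstrip N" and
          T = "interlaced (Suc N)" and h = "\<lambda>p. fps_X ^ pair_size p" and s' = "?F (Suc N)"])
       (auto simp: strip_unstrip unstrip_strip pair_size_unstrip simp del: mult_Suc_right
          intro: unstrip_in dest: strip_in)
qed

section \<open>From bounded pairs to all cylindric partitions\<close>

text \<open>If row \<open>j\<close> is nonzero, interlacing makes all rows before it nonzero, so the
  size is at least \<open>j + 1\<close>. Hence the pairs of a given size all occur at one finite
  stage.\<close>

lemma interlaced_bound: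
  assumes "(lam, mu) \<in> interlaced N" "pair_size (lam, mu) \<le> M"
  shows "(lam, mu) \<in> interlaced M"
proof -
  have "lam j = 0 \<and> mu j = 0" if "j \<ge> M" for j
  proof (rule ccontr)
    assume nz: "\<not> (lam j = 0 \<and> mu j = 0)"
    have "\<forall>j\<ge>N. lam j = 0 \<and> mu j = 0"
      using assms(1) by (simp add: interlaced_def)
    with nz have "j < N"
      using not_le by blast
    have "Suc j = (\<Sum>i<Suc j. 1)" by simp
    also have "\<dots> \<le> (\<Sum>i<Suc j. lam i + mu i)"
    proof (rule sum_mono)
      fix i assume "i \<in> {..<Suc j}"
      then show "1 \<le> lam i + mu i"
        using interlaced_antimono[OF assms(1), of i j] nz by (cases "i = j") auto
    qed
    also have "\<dots> \<le> (\<Sum>i<N. lam i + mu i)"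
      using \<open>j < N\<close> by (intro sum_mono2) auto
    also have "\<dots> \<le> M"
      using assms by (simp add: pair_size_eq_sum)
    finally show False using that by simp
  qed
  then show ?thesis
    using assms(1) by (auto simp: interlaced_def)
qed

lemma cylindric_partitions_1_1:
  "cylindric_partitions [1, 1] = (\<lambda>(lam, mu). [lam, mu]) ` (\<Union>N. interlaced N)"
proof (intro equalityI subsetI)
  fix L assume "L \<in> cylindric_partitions [1, 1]"
  then obtain lam mu where L: "L = [lam, mu]" and part: "is_partition lam" "is_partition mu"
    and le: "\<And>j. mu (Suc j) \<le> lam j" "\<And>j. lam (Suc j) \<le> mu j"
    unfolding cylindric_partitions_def by (auto simp: length_Suc_conv)
  \<comment> \<open>Finiteness of the union provides one bound \<open>N\<close> for both
    supports.\<close>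
  have "finite ({j. lam j \<noteq> 0} \<union> {j. mu j \<noteq> 0})"
    using part by (auto simp: is_partition_def)
  then obtain N where "\<forall>j\<in>{j. lam j \<noteq> 0} \<union> {j. mu j \<noteq> 0}. j < N"
    using finite_nat_set_iff_bounded by blast
  then have "\<forall>j\<ge>N. lam j = 0 \<and> mu j = 0"
    using not_le by blast
  moreover have "lam (Suc j) \<le> lam j" "mu (Suc j) \<le> mu j" for j
    using part by (auto simp: is_partition_def antimono_def)
  ultimately have "(lam, mu) \<in> interlaced N"
    using le by (auto simp: interlaced_def)
  then show "L \<in> (\<lambda>(lam, mu). [lam, mu]) ` (\<Union>N. interlaced N)"
    using L by force
next
  fix L assume "L \<in> (\<lambda>(lam, mu). [lam, mu]) ` (\<Union>N. interlaced N)"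
  then obtain lam mu N where L: "L = [lam, mu]" and int: "(lam, mu) \<in> interlaced N"
    by auto
  have "\<forall>j\<ge>N. lam j = 0 \<and> mu j = 0"
    using int by (simp add: interlaced_def)
  then have "{j. lam j \<noteq> 0} \<subseteq> {..<N}" "{j. mu j \<noteq> 0} \<subseteq> {..<N}"
    by (intro support_subset_lessThan; simp)+
  then have fin: "finite {j. lam j \<noteq> 0}" "finite {j. mu j \<noteq> 0}"
    by (auto intro: finite_subset)
  have "antimono lam" "antimono mu"
    using int by (auto simp: interlaced_def antimono_iff_le_Suc)
  with fin int show "L \<in> cylindric_partitions [1, 1]"
    by (auto simp: cylindric_partitions_def is_partition_def interlaced_def L less_Suc_eq)
qed

theorem theorem3p1:
  shows "((\<lambda>L. (fps_X :: complex fps) ^ cylindric_size L) has_sum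
            (qpoch_inf (- fps_X) (fps_X ^ 2) / qpoch_inf fps_X fps_X))
          (cylindric_partitions [1, 1])"
proof -
  let ?P = "qpoch_inf fps_X fps_X :: complex fps"
  let ?Q = "qpoch_inf (- fps_X) (fps_X ^ 2) :: complex fps"
  have P0: "fps_nth ?P 0 \<noteq> 0"
    by (subst qpoch_inf_fps_nth_0) auto
  \<comment> \<open>The denominators run through even indices only; a subsequence keeps the
    limit.\<close>
  have "(\<lambda>N. qpoch fps_X fps_X (2 * N)) \<longlonglongrightarrow> ?P"
    by (rule LIMSEQ_subseq_LIMSEQ[OF tendsto_qpoch_fps, unfolded o_def])
       (auto simp: strict_mono_def)
  then have lim: "(\<lambda>N. qpoch (- fps_X) (fps_X ^ 2) N * inverse (qpoch fps_X fps_X (2 * N)))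
      \<longlonglongrightarrow> ?Q * inverse ?P"
    by (intro tendsto_mult_fps tendsto_inverse_fps tendsto_qpoch_fps P0) auto
  \<comment> \<open>By \<open>interlaced_bound\<close> the fibre over \<open>n\<close> is complete
    from \<open>N = n\<close> on.\<close>
  have fibre: "eventually (\<lambda>N. {p \<in> interlaced N. pair_size p = n} =
      {p \<in> (\<Union>N. interlaced N). pair_size p = n}) sequentially" for n
    using eventually_ge_at_top[of n]
    by eventually_elim (auto dest: interlaced_bound)
  have "((\<lambda>p. fps_X ^ pair_size p) has_sum ?Q * inverse ?P) (\<Union>N. interlaced N)"
    by (rule has_sum_fps_X_power_limit[OF has_sum_interlaced lim fibre])
  moreover have "inj_on (\<lambda>(lam, mu). [lam, mu]) (\<Union>N. interlaced N)"
    by (auto simp: inj_on_def)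
  ultimately show ?thesis
    unfolding cylindric_partitions_1_1
    by (subst has_sum_reindex)
       (auto simp: o_def case_prod_unfold cylindric_size_def pair_size_def fps_divide_unit[OF P0])
qed

end
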